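(* Let $p$ be a nonnegative integer. Then $$\sum_{a+b+c=p}\left(\sum_{|\boldsymbol{\alpha}|=a+b+1}\zeta(\alpha_0,\ldots,\alpha_{a-1},\alpha_a+1,c+2)+\sum_{|\boldsymbol{\beta}|=b+c+1}\zeta(a+2,\beta_0,\ldots,\beta_{b-1},\beta_b+1)\right)$$ $$=\frac{p+2}{2}\sum_{m+n=p}\zeta(m+2)\zeta(n+2)-\frac{(p+1)(p+2)}{2}\zeta(p+4),$$ where $a,b,c,m,n$ run over nonnegative integers, $\boldsymbol{\alpha}=(\alpha_0,\ldots,\alpha_a)$ runs over $(a+1)$-tuples of positive integers with sum $a+b+1$, and $\boldsymbol{\beta}=(\beta_0,\ldots,\beta_b)$ runs over $(b+1)$-tuples of positive integers with sum $b+c+1$.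
   Context: For an $r$-tuple $(\alpha_1,\ldots,\alpha_r)$ of positive integers with $\alpha_r\ge 2$, the multiple zeta value is $\zeta(\alpha_1,\ldots,\alpha_r)=\sum_{1\le k_1<k_2<\cdots<k_r} k_1^{-\alpha_1}k_2^{-\alpha_2}\cdots k_r^{-\alpha_r}$. When $a=0$, the string $\alpha_0,\ldots,\alpha_{a-1},\alpha_a+1$ means just $\alpha_0+1$; similarly for $\boldsymbol{\beta}$ when $b=0$. *)

theory Defs
  imports "HOL-Analysis.Analysis"
begin

(* Convention: the indices increase, so the last argument is the one that must be at least 2 for
   convergence.  All terms are nonnegative, so unordered summation agrees with iterated summation;
   on divergent arguments infsum yields the junk value 0. *)
definition mzv :: "nat list \<Rightarrow> real" where
  "mzv s = (\<Sum>\<^sub>\<infinity>k\<in>{k :: nat list. length k = length s \<and> sorted_wrt (<) k \<and> (\<forall>x\<in>set k. 1 \<le> x)}.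
              \<Prod>i<length s. 1 / real (k ! i) ^ (s ! i))"

definition pos_tuples :: "nat \<Rightarrow> nat \<Rightarrow> nat list set" where
  "pos_tuples l n = {s. length s = l \<and> (\<forall>x\<in>set s. 1 \<le> x) \<and> sum_list s = n}"

(* Finiteness matters because a sum over an infinite set is 0 by convention. *)
lemma finite_pos_tuples: "finite (pos_tuples l n)"
proof (rule finite_subset)
  show "pos_tuples l n \<subseteq> {s. set s \<subseteq> {..n} \<and> length s = l}"
    by (auto simp: pos_tuples_def intro: member_le_sum_list)
qed (rule finite_lists_length_eq, simp)

end

theory Submission
  imports Defs
begin

text \<open>
  For $0 \le x < 1$ multiply the identity by $x^p$ and sum over $p$. A chain of summation indices
  whose exponents run over all compositions has generating function $\prod_k k/(k-x)$, the product
  being over the range of the chain (\<open>composition_sum_sums\<close>). Write $w_n = 1/(n(n-x))$ and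
  $Q_n = \prod_{k\le n} k/(k-x)$. In the first kind of multiple zeta value the composition sits
  below the last two indices $m<n$, in the second kind strictly between the first index $m$ and
  the last index $n$. The two generating functions are therefore
  $$G_1=\sum_{m<n} Q_{m-1}\,w_m w_n, \qquad G_2=\sum_{m<n} w_m w_n\, Q_{n-1}/Q_m .$$

  The right-hand side becomes, after symmetrising $\sum_{u+v=p}(v+1)\zeta(u+2)\zeta(v+2)$ and
  removing the diagonal, the sum of $w_b/(j-x)^2$ over all $b\ne j$. The proof shows that $G_1$ is
  the part with $b<j$ and $G_2$ the part with $j<b$.

  Both evaluations use connected sums. With $P_n = (1-x)(2-x)\cdots(n-x)$ put
  $C(m,n) = P_m P_n/P_{m+n}$ and $D(m,n) = Q_m C(m,n)$. They telescope (\<open>sum_connector\<close>,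
  \<open>sum_scaled_connector\<close>):
  $$\sum_{b>n}\frac{C(m,b)}{b-x}=\frac{C(m,n)}{m},\qquad
    \sum_{a>m}\frac{D(a,n)}{a}=\frac{D(m,n)}{n-x}.$$
  Evaluating a double series of such terms by rows and by columns moves a factor from one index to
  the other, which gives the three transport rules
  $$\sum_{m\ge1}\frac{D(m,b)}{m^2}=\sum_{j>b}\frac1{(j-x)^2},\qquad
    \sum_{b\ge1}C(m,b)\,w_b=\sum_{n>m}w_n,\qquad
    \sum_{j\ge1}\frac{D(m,j)}{(j-x)^2}=\sum_{n>m}\frac{Q_n}{n^2}.$$
  As $Q_{m-1}w_m = Q_m/m^2$, the first two rules turn $\sum_{b<j} w_b/(j-x)^2$ into $G_1$
  (\<open>first_generating_sum\<close>), and the last two turn $\sum_{j<b} w_b/(j-x)^2$ into $G_2$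
  (\<open>second_generating_sum\<close>).

  All terms, and all coefficients in $x$, are nonnegative. Hence every interchange of summations is
  legitimate, convergence of the multiple zeta values comes along with the identity, and equality
  of the generating functions on $(0,1)$ can be read off coefficient by coefficient
  (\<open>coefficientwise_equality\<close>).
\<close>

section \<open>Sums of nonnegative families and power series\<close>

lemma has_sum_telescope:
  fixes f g :: "nat \<Rightarrow> real"
  assumes "\<And>k. k > n \<Longrightarrow> f k = g (k - 1) - g k"
    and "\<And>k. k > n \<Longrightarrow> 0 \<le> f k" and "g \<longlonglongrightarrow> 0"
  shows "(f has_sum g n) {n<..}"
proof -
  have "(\<lambda>i. g (i + n)) \<longlonglongrightarrow> 0"
    using assms(3) by (rule LIMSEQ_ignore_initial_segment)
  from telescope_sums'[OF this]
  have "(\<lambda>i. f (Suc (i + n))) sums g n"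
    using assms(1) by simp
  hence "((\<lambda>i. f (Suc (i + n))) has_sum g n) UNIV"
    by (rule sums_nonneg_imp_has_sum) (use assms(2) in auto)
  also have "?this \<longleftrightarrow> ?thesis"
    by (rule has_sum_reindex_bij_witness[where i = "\<lambda>k. k - Suc n" and j = "\<lambda>i. Suc (i + n)"]) auto
  finally show ?thesis .
qed

lemma has_sum_SigmaI_nonneg:
  fixes f :: "'a \<times> 'b \<Rightarrow> real"
  assumes "\<And>x. x \<in> A \<Longrightarrow> ((\<lambda>y. f (x, y)) has_sum g x) (B x)" and "(g has_sum S) A"
    and "\<And>x y. x \<in> A \<Longrightarrow> y \<in> B x \<Longrightarrow> 0 \<le> f (x, y)"
  shows "(f has_sum S) (Sigma A B)"
  using assms by (intro has_sum_SigmaI summable_on_SigmaI has_sum_imp_summable) auto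

text \<open>
  Tonelli's theorem in the form in which a double series is evaluated twice: nonnegativity makes the
  total of the row sums the total of the column sums as well.
\<close>
lemma has_sum_swap_nonneg:
  fixes f :: "'a \<Rightarrow> 'b \<Rightarrow> real"
  assumes "\<And>a. a \<in> A \<Longrightarrow> (f a has_sum r a) B" and "(r has_sum S) A"
    and "\<And>b. b \<in> B \<Longrightarrow> ((\<lambda>a. f a b) has_sum c b) A"
    and "\<And>a b. a \<in> A \<Longrightarrow> b \<in> B \<Longrightarrow> 0 \<le> f a b"
  shows "(c has_sum S) B"
proof -
  have "((\<lambda>(a, b). f a b) has_sum S) (A \<times> B)"
    using assms by (intro has_sum_SigmaI_nonneg[where g = r]) auto
  hence "((\<lambda>(b, a). f a b) has_sum S) (B \<times> A)"
    by (subst (asm) has_sum_swap) (simp add: case_prod_unfold)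
  thus ?thesis
    by (rule has_sum_SigmaD) (use assms(3) in auto)
qed

text \<open>
  If one side diverges, so does the other, and both are then $0$ by convention. A multiple zeta value
  can therefore be regrouped before its convergence is known.
\<close>
lemma infsum_Sigma_finite_fibres:
  fixes f :: "'a \<times> 'b \<Rightarrow> real"
  assumes fin: "\<And>x. x \<in> A \<Longrightarrow> finite (B x)"
    and nonneg: "\<And>x y. x \<in> A \<Longrightarrow> y \<in> B x \<Longrightarrow> 0 \<le> f (x, y)"
  shows "infsum f (Sigma A B) = (\<Sum>\<^sub>\<infinity>x\<in>A. \<Sum>y\<in>B x. f (x, y))"
proof (cases "f summable_on Sigma A B")
  case True
  have "((\<lambda>x. \<Sum>y\<in>B x. f (x, y)) has_sum infsum f (Sigma A B)) A"
    by (rule has_sum_SigmaD[OF has_sum_infsum[OF True]]) (simp add: fin)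
  thus ?thesis by (simp add: infsumI)
next
  case False
  hence "\<not> (\<lambda>x. \<Sum>y\<in>B x. f (x, y)) summable_on A"
    using summable_on_SigmaI[of A f B "\<lambda>x. \<Sum>y\<in>B x. f (x, y)"] fin nonneg by auto
  thus ?thesis using False by (simp add: infsum_not_exists)
qed

lemma has_sum_finite_sum:
  fixes f :: "'i \<Rightarrow> 'a \<Rightarrow> real"
  assumes "finite F" "\<And>i. i \<in> F \<Longrightarrow> (f i has_sum v i) A"
  shows "((\<lambda>x. \<Sum>i\<in>F. f i x) has_sum (\<Sum>i\<in>F. v i)) A"
  using assms by (induction F rule: finite_induct) (auto intro!: has_sum_add)

text \<open>
  Each member of a finite nonnegative family is dominated by the total, so convergence of the total
  alone allows the two sums to be exchanged.
\<close>
lemma sum_infsum_dominated: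
  fixes h :: "'i \<Rightarrow> 'a \<Rightarrow> real"
  assumes "finite F" and "\<And>i y. 0 \<le> h i y"
    and "((\<lambda>y. \<Sum>i\<in>F. h i y) has_sum v) A"
  shows "(\<Sum>i\<in>F. infsum (h i) A) = v"
proof -
  have "h i summable_on A" if "i \<in> F" for i
    by (rule summable_on_comparison_test[OF has_sum_imp_summable[OF assms(3)]])
       (use assms(1,2) that in \<open>auto intro: member_le_sum\<close>)
  hence "((\<lambda>y. \<Sum>i\<in>F. h i y) has_sum (\<Sum>i\<in>F. infsum (h i) A)) A"
    by (intro has_sum_finite_sum assms has_sum_infsum)
  thus ?thesis using assms(3) by (rule has_sum_unique)
qed

lemma summable_inverse_squares: "(\<lambda>n. 1 / real n ^ 2) summable_on A"
proof -
  have "(\<lambda>n. 1 / real n ^ 2) summable_on UNIV"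
    using inverse_power_summable[of 2, where 'a = real]
    by (subst summable_on_UNIV_nonneg_real_iff) (auto simp: divide_inverse)
  thus ?thesis by (rule summable_on_subset_banach) auto
qed

definition cauchy_prod :: "(nat \<Rightarrow> real) \<Rightarrow> (nat \<Rightarrow> real) \<Rightarrow> nat \<Rightarrow> real" where
  "cauchy_prod a b n = (\<Sum>i\<le>n. a i * b (n - i))"

lemma cauchy_prod_nonneg: "(\<And>i. 0 \<le> a i) \<Longrightarrow> (\<And>i. 0 \<le> b i) \<Longrightarrow> 0 \<le> cauchy_prod a b n"
  unfolding cauchy_prod_def by (intro sum_nonneg mult_nonneg_nonneg) auto

lemma cauchy_prod_sums:
  fixes a b :: "nat \<Rightarrow> real"
  assumes "\<And>n. 0 \<le> a n" "\<And>n. 0 \<le> b n" "0 \<le> x"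
    and "(\<lambda>n. a n * x ^ n) sums A" "(\<lambda>n. b n * x ^ n) sums B"
  shows "(\<lambda>n. cauchy_prod a b n * x ^ n) sums (A * B)"
proof -
  have "(\<lambda>n. \<Sum>i\<le>n. (a i * x ^ i) * (b (n - i) * x ^ (n - i))) sums
          ((\<Sum>n. a n * x ^ n) * (\<Sum>n. b n * x ^ n))"
    by (rule Cauchy_product_sums) (use assms in \<open>auto simp: sums_iff\<close>)
  moreover have "(\<Sum>i\<le>n. (a i * x ^ i) * (b (n - i) * x ^ (n - i))) = cauchy_prod a b n * x ^ n" for n
    unfolding cauchy_prod_def sum_distrib_right
    by (intro sum.cong refl) (auto simp: mult_ac power_add[symmetric])
  ultimately show ?thesis using assms by (simp add: sums_iff)
qed

lemma geometric_sums_inverse: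
  assumes "0 \<le> x" "x < real N"
  shows "(\<lambda>n. 1 / real N ^ n * x ^ n) sums (real N / (real N - x))"
  using geometric_sums[of "x / real N"] assms
  by (simp add: power_divide divide_simps split: if_splits)

text \<open>
  The hypothesis only concerns positive arguments, so the identity theorem is replaced by taking the
  limit at $0$ from the right: once the earlier coefficients vanish, divide by $x^n$.
\<close>
lemma powser_zero_coeffs:
  fixes d :: "nat \<Rightarrow> real"
  assumes "\<And>x. 0 < x \<Longrightarrow> x < 1 \<Longrightarrow> (\<lambda>n. d n * x ^ n) sums 0"
  shows "d n = 0"
proof (induction n rule: less_induct)
  case (less n)
  have shift: "(\<lambda>i. d (i + n) * x ^ i) sums 0" if "0 < x" "x < 1" for x
  proof -
    have "(\<lambda>i. d (i + n) * x ^ (i + n)) sums 0"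
      by (subst sums_zero_iff_shift) (use less assms[OF that] in auto)
    from sums_mult[OF this, of "1 / x ^ n"] show ?thesis
      using that by (simp add: power_add)
  qed
  have smm: "summable (\<lambda>i. d (i + n) * (1/2) ^ i)"
    using shift[of "1/2"] by (simp add: sums_iff)
  have "((\<lambda>x. \<Sum>i. d (i + n) * x ^ i) \<longlongrightarrow> d (0 + n)) (at 0)"
  proof (rule powser_limit_0[where a = "\<lambda>i. d (i + n)" and s = "1/2"])
    fix x :: real assume x: "norm x < 1/2"
    show "(\<lambda>i. d (i + n) * x ^ i) sums (\<Sum>i. d (i + n) * x ^ i)"
      by (rule summable_sums, rule powser_inside[OF smm]) (use x in simp)
  qed simp
  hence "((\<lambda>x. \<Sum>i. d (i + n) * x ^ i) \<longlongrightarrow> d n) (at_right 0)"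
    unfolding filterlim_at_split by simp
  moreover have "((\<lambda>x. \<Sum>i. d (i + n) * x ^ i) \<longlongrightarrow> 0) (at_right 0)"
  proof (rule tendsto_eventually)
    have *: "(\<Sum>i. d (i + n) * x ^ i) = 0" if "0 < x" "x < 1" for x
      using sums_unique[OF shift[OF that]] by simp
    show "\<forall>\<^sub>F x in at_right 0. (\<Sum>i. d (i + n) * x ^ i) = 0"
      unfolding eventually_at_right_field using * by (intro exI[of _ 1]) auto
  qed
  ultimately show "d n = 0"
    by (rule tendsto_unique[OF trivial_limit_at_right_real])
qed

text \<open>
  With nonnegative coefficients, summing a family of power series at a single point $x>0$ already
  shows that every coefficient is summable over the family.
\<close>
lemma powser_family_sums:
  fixes a :: "nat \<Rightarrow> 'i \<Rightarrow> real"
  assumes nonneg: "\<And>p i. i \<in> S \<Longrightarrow> 0 \<le> a p i"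
    and sums: "\<And>i. i \<in> S \<Longrightarrow> (\<lambda>p. a p i * x ^ p) sums F i"
    and "(F has_sum V) S" and x: "0 < x"
  shows "a p summable_on S" and "(\<lambda>p. infsum (a p) S * x ^ p) sums V"
proof -
  have rows: "((\<lambda>p. a p i * x ^ p) has_sum F i) UNIV" if "i \<in> S" for i
    using sums[OF that] nonneg[OF that] x by (intro sums_nonneg_imp_has_sum) auto
  have "((\<lambda>(i, p). a p i * x ^ p) has_sum V) (S \<times> UNIV)"
    using rows assms by (intro has_sum_SigmaI_nonneg[where g = F]) auto
  hence "((\<lambda>(p, i). a p i * x ^ p) has_sum V) (UNIV \<times> S)"
    by (subst (asm) has_sum_swap) (simp add: case_prod_unfold)
  hence "(\<lambda>i. a p i * x ^ p) summable_on S" for p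
    using summable_on_SigmaD1[of "\<lambda>p i. a p i * x ^ p" UNIV "\<lambda>_. S" p] by (simp add: has_sum_imp_summable)
  note summ' = this
  have summ: "a p summable_on S" for p
    using summable_on_cmult_left[OF summ'[of p], of "1 / x ^ p"] x by simp
  thus "a p summable_on S" .
  have "((\<lambda>p. infsum (a p) S * x ^ p) has_sum V) UNIV"
    by (rule has_sum_swap_nonneg[OF rows assms(3)])
       (use summ x nonneg in \<open>auto intro!: has_sum_cmult_left\<close>)
  thus "(\<lambda>p. infsum (a p) S * x ^ p) sums V"
    by (rule has_sum_imp_sums)
qed

text \<open>
  The bridge from generating functions back to fixed weight: two families of power series with
  nonnegative coefficients and the same total on $(0,1)$ have the same totals in every degree.
\<close>
lemma coefficientwise_equality:
  fixes a :: "nat \<Rightarrow> 'i \<Rightarrow> real" and b :: "nat \<Rightarrow> 'j \<Rightarrow> real"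
  assumes "\<And>p i. i \<in> S \<Longrightarrow> 0 \<le> a p i" "\<And>p j. j \<in> S' \<Longrightarrow> 0 \<le> b p j"
    and "\<And>x i. 0 < x \<Longrightarrow> x < 1 \<Longrightarrow> i \<in> S \<Longrightarrow> (\<lambda>p. a p i * x ^ p) sums F x i"
    and "\<And>x j. 0 < x \<Longrightarrow> x < 1 \<Longrightarrow> j \<in> S' \<Longrightarrow> (\<lambda>p. b p j * x ^ p) sums G x j"
    and "\<And>x. 0 < x \<Longrightarrow> x < 1 \<Longrightarrow> (F x has_sum V x) S"
    and "\<And>x. 0 < x \<Longrightarrow> x < 1 \<Longrightarrow> (G x has_sum V x) S'"
  shows "(a p has_sum infsum (b p) S') S" and "b p summable_on S'"
proof -
  have "infsum (a p) S - infsum (b p) S' = 0"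
  proof (rule powser_zero_coeffs[where d = "\<lambda>p. infsum (a p) S - infsum (b p) S'"])
    fix x :: real assume "0 < x" "x < 1"
    hence "(\<lambda>p. infsum (a p) S * x ^ p) sums V x" "(\<lambda>p. infsum (b p) S' * x ^ p) sums V x"
      using assms by (auto intro!: powser_family_sums(2))
    from sums_diff[OF this] show "(\<lambda>p. (infsum (a p) S - infsum (b p) S') * x ^ p) sums 0"
      by (simp add: algebra_simps)
  qed
  moreover have "a p summable_on S"
    \<comment> \<open>any point of the open unit interval would do\<close>
    using assms by (intro powser_family_sums(1)[of S a "1/2" "F (1/2)" "V (1/2)"]) auto
  ultimately show "(a p has_sum infsum (b p) S') S"
    by (simp add: has_sum_iff)
  show "b p summable_on S'"
    using assms by (intro powser_family_sums(1)[of S' b "1/2" "G (1/2)" "V (1/2)"]) auto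
qed

section \<open>The connector and its telescoping sums\<close>

text \<open>This is $Q_n=\prod_{k=1}^n k/(k-x)$, as the Pochhammer symbol is $(1-x)(2-x)\cdots(n-x)$.\<close>
definition fact_ratio :: "real \<Rightarrow> nat \<Rightarrow> real" where
  "fact_ratio x n = fact n / pochhammer (1 - x) n"

text \<open>
  For $x=0$ this is the inverse binomial coefficient $m!\,n!/(m+n)!$. The factor $Q_m$ turns it into
  $D(m,n)=m!\,P_n/P_{m+n}$; in what follows $D$ is written as that product.
\<close>
definition connector :: "real \<Rightarrow> nat \<Rightarrow> nat \<Rightarrow> real" where
  "connector x m n = pochhammer (1 - x) m * pochhammer (1 - x) n / pochhammer (1 - x) (m + n)"

definition kernel :: "real \<Rightarrow> nat \<Rightarrow> real" where
  "kernel x n = 1 / (real n * (real n - x))"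

context
  fixes x :: real
  assumes x: "0 \<le> x" "x < 1"
begin

lemma poch_pos: "0 < pochhammer (1 - x) n"
  using x by (intro pochhammer_pos) auto

lemma fact_ratio_pos: "0 < fact_ratio x n"
  unfolding fact_ratio_def using poch_pos by (intro divide_pos_pos) auto

lemma connector_pos: "0 < connector x m n"
  unfolding connector_def using poch_pos by (intro divide_pos_pos mult_pos_pos) auto

lemma connector_commute: "connector x m n = connector x n m"
  by (simp add: connector_def add.commute)

lemma connector_0: "connector x m 0 = 1" "connector x 0 m = 1"
  using poch_pos[of m] by (auto simp: connector_def)

lemma fact_ratio_0: "fact_ratio x 0 = 1"
  by (simp add: fact_ratio_def)

lemma fact_ratio_Suc: "fact_ratio x (Suc n) = fact_ratio x n * (real (Suc n) / (real (Suc n) - x))"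
  by (simp add: fact_ratio_def pochhammer_Suc add_ac mult_ac diff_add_eq)

lemma connector_Suc: "connector x m (Suc n) = connector x m n * ((real (Suc n) - x) / (real (Suc n) - x + real m))"
  by (simp add: connector_def pochhammer_Suc algebra_simps)

text \<open>Here $C(m,n+1)/C(m,n) = s/(s+m)$ with $s=n+1-x$, and $1-s/(s+m)=m/(s+m)$.\<close>
lemma connector_diff: "connector x m n - connector x m (Suc n) = real m * (connector x m (Suc n) / (real (Suc n) - x))"
proof -
  define s where "s = real (Suc n) - x"
  have "s > 0" using x by (simp add: s_def)
  have "c - c * (s / (s + real m)) = real m * (c * (s / (s + real m)) / s)" for c
  proof -
    have "s \<noteq> 0" "s + real m \<noteq> 0" using \<open>s > 0\<close> by auto
    thus ?thesis by (simp add: divide_simps) (simp add: algebra_simps)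
  qed
  thus ?thesis unfolding connector_Suc s_def .
qed

lemma scaled_connector_diff:
  "fact_ratio x m * connector x m n - fact_ratio x (Suc m) * connector x (Suc m) n
     = (real n - x) * (fact_ratio x (Suc m) * connector x (Suc m) n / real (Suc m))"
proof -
  define s where "s = real (Suc m) - x"
  have s: "s > 0" using x by (simp add: s_def)
  have 1: "q * c - q * (k / s) * (c * (s / (s + real n)))
          = (s + real n - k) * (q * (k / s) * (c * (s / (s + real n))) / k)" if "k > 0" for k q c
  proof -
    have "s \<noteq> 0" "s + real n \<noteq> 0" "k \<noteq> 0" using s that by auto
    thus ?thesis by (simp add: divide_simps) (simp add: algebra_simps)
  qed
  have 2: "connector x (Suc m) n = connector x m n * ((real (Suc m) - x) / (real (Suc m) - x + real n))"
    using connector_Suc[of n m] by (simp add: connector_commute)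
  have 3: "real n - x = s + real n - real (Suc m)" by (simp add: s_def)
  show ?thesis unfolding fact_ratio_Suc 2 3 unfolding s_def[symmetric] by (rule 1) simp
qed

lemma connector_le_1: "connector x m n \<le> 1"
proof (induction n)
  case (Suc n)
  have "real (Suc n) - x > 0" using x by auto
  hence "(real (Suc n) - x) / (real (Suc n) - x + real m) \<le> 1" by simp
  moreover have "0 \<le> (real (Suc n) - x) / (real (Suc n) - x + real m)" 
    using \<open>real (Suc n) - x > 0\<close> by simp
  ultimately show ?case unfolding connector_Suc using Suc connector_pos[of m n]
    by (intro mult_le_one) auto
qed (simp add: connector_0)

lemma connector_tendsto_0:
  assumes "m > 0" shows "(\<lambda>n. connector x m n) \<longlonglongrightarrow> 0"
proof -
  obtain k where k: "m = Suc k" using assms by (cases m) auto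
  have le: "connector x m n \<le> (real m - x) / (real m - x + real n)" for n
  proof -
    have "connector x m n = connector x k n * ((real m - x) / (real m - x + real n))"
      using connector_Suc[of n k] by (simp add: connector_commute k)
    moreover have "0 \<le> (real m - x) / (real m - x + real n)"
      using x assms by (intro divide_nonneg_nonneg) auto
    ultimately show ?thesis
      using connector_le_1[of k n] mult_right_mono by fastforce
  qed
  have "(\<lambda>n. (real m - x) / (real m - x + real n)) \<longlonglongrightarrow> 0"
    by (intro tendsto_divide_0[OF tendsto_const] filterlim_at_top_imp_at_infinity
         filterlim_tendsto_add_at_top[OF tendsto_const] filterlim_real_sequentially)
  thus ?thesis
    by (rule tendsto_sandwich[OF _ _ tendsto_const, rotated 2])
       (use le connector_pos in \<open>auto intro!: always_eventually simp: less_imp_le\<close>)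
qed

text \<open>
  The decay is only of order $m^{-z}$ with $z=n-x>0$, where $z$ may be close to $0$. The expression
  equals $m!/((z+1)\cdots(z+m))$, which is $z\,m^{-z}$ times the $m$-th term of a sequence
  converging to $\Gamma(z)$.
\<close>
lemma scaled_connector_tendsto_0:
  assumes "n > 0" shows "(\<lambda>m. fact_ratio x m * connector x m n) \<longlonglongrightarrow> 0"
proof -
  define z where "z = real n - x"
  have z: "z > 0" using assms x by (simp add: z_def)
  have "(\<lambda>m. exp (- z * ln (real m))) \<longlonglongrightarrow> 0"
    by (intro filterlim_compose[OF exp_at_bot]
        filterlim_tendsto_neg_mult_at_bot[OF tendsto_const] filterlim_compose[OF ln_at_top]
          filterlim_real_sequentially) (use z in auto)
  hence "(\<lambda>m. Gamma_series z m * exp (- z * ln (real m)) * z) \<longlonglongrightarrow> Gamma z * 0 * z"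
    by (intro tendsto_mult Gamma_series_LIMSEQ tendsto_const)
  moreover have "Gamma_series z m * exp (- z * ln (real m)) * z = fact_ratio x m * connector x m n"
    for m
  proof -
    have "pochhammer (1 - x) (m + n) = pochhammer (1 - x) n * pochhammer (z + 1) m"
      by (subst add.commute, subst pochhammer_product') (simp add: z_def algebra_simps)
    hence "fact_ratio x m * connector x m n = fact m / pochhammer (z + 1) m"
      using poch_pos[of m] poch_pos[of n] by (simp add: fact_ratio_def connector_def)
    moreover have "pochhammer z (m + 1) = z * pochhammer (z + 1) m"
      by (simp add: pochhammer_rec)
    ultimately show ?thesis using z
      by (simp add: Gamma_series_def exp_minus field_simps)
  qed
  ultimately show ?thesis by simp
qed

lemma sum_connector:
  assumes "m > 0"
  shows "((\<lambda>b. connector x m b / (real b - x)) has_sum connector x m n / real m) {n<..}"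
proof (rule has_sum_telescope)
  fix k assume "k > n"
  then obtain j where "k = Suc j" by (cases k) auto
  thus "connector x m k / (real k - x) = connector x m (k - 1) / real m - connector x m k / real m"
    using connector_diff[of m j] assms by (simp add: diff_divide_distrib[symmetric])
  show "0 \<le> connector x m k / (real k - x)"
    using \<open>k > n\<close> x connector_pos[of m k] by (intro divide_nonneg_nonneg) auto
qed (use connector_tendsto_0[OF assms] in \<open>simp add: tendsto_divide_zero\<close>)

lemma sum_connector':
  assumes "n > 0"
  shows "((\<lambda>a. connector x a n / (real a - x)) has_sum connector x m n / real n) {m<..}"
  using sum_connector[OF assms, of m] by (simp add: connector_commute)

lemma sum_scaled_connector:
  assumes "n > 0"
  shows "((\<lambda>a. fact_ratio x a * connector x a n / real a) has_sum fact_ratio x m * connector x m n / (real n - x)) {m<..}"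
proof (rule has_sum_telescope)
  have n: "real n - x > 0" using assms x by auto
  fix k assume "k > m"
  then obtain j where "k = Suc j" by (cases k) auto
  thus "fact_ratio x k * connector x k n / real k
          = fact_ratio x (k - 1) * connector x (k - 1) n / (real n - x) - fact_ratio x k * connector x k n / (real n - x)"
    using scaled_connector_diff[of j n] n by (simp add: diff_divide_distrib[symmetric])
  show "0 \<le> fact_ratio x k * connector x k n / real k"
    using connector_pos[of k n] fact_ratio_pos[of k] by simp
qed (use scaled_connector_tendsto_0[OF assms] in \<open>simp add: tendsto_divide_zero\<close>)

lemma kernel_nonneg: "0 \<le> kernel x n"
  using x by (cases n) (auto simp: kernel_def)

text \<open>
  Evaluate $\sum_{j>b}\sum_{m\ge1} D(m,j)/((j-x)m)$ in both orders. The sum over $m$ starts from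
  $D(0,j)=1$ and leaves $1/(j-x)^2$; the sum over $j$ leaves $D(m,b)/m^2$.
\<close>
lemma transport_square:
  assumes "((\<lambda>j. 1 / (real j - x)^2) has_sum R) {b<..}"
  shows "((\<lambda>m. fact_ratio x m * connector x m b / real m ^ 2) has_sum R) {0<..}"
proof (rule has_sum_swap_nonneg[OF _ assms,
      where f = "\<lambda>j m. fact_ratio x m * connector x m j / ((real j - x) * real m)"])
  fix j assume j: "j \<in> {b<..}"
  show "((\<lambda>m. fact_ratio x m * connector x m j / ((real j - x) * real m)) has_sum 1 / (real j - x)^2) {0<..}"
    using has_sum_cmult_right[OF sum_scaled_connector[of j 0], of "1 / (real j - x)"] j
    by (simp add: connector_0 fact_ratio_0 power2_eq_square mult_ac)
next
  fix m :: nat assume m: "m \<in> {0<..}"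
  show "((\<lambda>j. fact_ratio x m * connector x m j / ((real j - x) * real m)) has_sum fact_ratio x m * connector x m b / real m ^ 2) {b<..}"
    using has_sum_cmult_right[OF sum_connector[of m b], of "fact_ratio x m / real m"] m
    by (simp add: power2_eq_square mult_ac)
next
  fix j m :: nat assume "j \<in> {b<..}" "m \<in> {0<..}"
  thus "0 \<le> fact_ratio x m * connector x m j / ((real j - x) * real m)"
    using x connector_pos[of m j] fact_ratio_pos[of m] by auto
qed

text \<open>
  Evaluate $\sum_{n>m}\sum_{b\ge1} C(n,b)/((n-x)(b-x))$ in both orders; by symmetry of $C$ the same
  telescoping applies to either index.
\<close>
lemma transport_kernel:
  assumes "(kernel x has_sum R) {m<..}"
  shows "((\<lambda>b. connector x m b * kernel x b) has_sum R) {0<..}"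
proof (rule has_sum_swap_nonneg[OF _ assms,
      where f = "\<lambda>n b. connector x n b / ((real n - x) * (real b - x))"])
  fix n assume n: "n \<in> {m<..}"
  show "((\<lambda>b. connector x n b / ((real n - x) * (real b - x))) has_sum kernel x n) {0<..}"
    using has_sum_cmult_right[OF sum_connector[of n 0], of "1 / (real n - x)"] n
    by (simp add: connector_0 kernel_def mult_ac)
next
  fix b :: nat assume b: "b \<in> {0<..}"
  show "((\<lambda>n. connector x n b / ((real n - x) * (real b - x))) has_sum connector x m b * kernel x b) {m<..}"
    using has_sum_cmult_right[OF sum_connector'[of b m], of "1 / (real b - x)"] b
    by (simp add: kernel_def mult_ac)
next
  fix n b :: nat assume "n \<in> {m<..}" "b \<in> {0<..}"
  thus "0 \<le> connector x n b / ((real n - x) * (real b - x))"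
    using x connector_pos[of n b] by auto
qed

text \<open>
  Evaluate $\sum_{j\ge1}\sum_{n>m} D(n,j)/(n(j-x))$ in both orders. The sum over $j$ starts from
  $D(n,0)=Q_n$.
\<close>
lemma transport_fact_ratio:
  assumes "((\<lambda>j::nat. fact_ratio x m * connector x m j / (real j - x)^2) has_sum R) {0<..}"
  shows "((\<lambda>n. fact_ratio x n / real n ^ 2) has_sum R) {m<..}"
proof (rule has_sum_swap_nonneg[OF _ assms,
      where f = "\<lambda>j n. fact_ratio x n * connector x n j / (real n * (real j - x))"])
  fix j :: nat assume j: "j \<in> {0<..}"
  show "((\<lambda>n. fact_ratio x n * connector x n j / (real n * (real j - x))) has_sum fact_ratio x m * connector x m j / (real j - x)^2) {m<..}"
    using has_sum_cmult_right[OF sum_scaled_connector[of j m], of "1 / (real j - x)"] j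
    by (simp add: power2_eq_square mult_ac)
next
  fix n assume n: "n \<in> {m<..}"
  show "((\<lambda>j. fact_ratio x n * connector x n j / (real n * (real j - x))) has_sum fact_ratio x n / real n ^ 2) {0<..}"
    using has_sum_cmult_right[OF sum_connector[of n 0], of "fact_ratio x n / real n"] n
    by (simp add: connector_0 power2_eq_square mult_ac)
next
  fix j n :: nat assume "j \<in> {0<..}" "n \<in> {m<..}"
  thus "0 \<le> fact_ratio x n * connector x n j / (real n * (real j - x))"
    using x connector_pos[of n j] fact_ratio_pos[of n] by auto
qed

lemma diff_ge: "n > 0 \<Longrightarrow> real n * (1 - x) \<le> real n - x"
  using x mult_right_mono[of 1 "real n" x] by (simp add: algebra_simps)

lemma summable_kernel: "A \<subseteq> {0<..} \<Longrightarrow> kernel x summable_on A"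
proof (rule summable_on_comparison_test[OF summable_on_cmult_right[OF summable_inverse_squares]])
  fix n assume "A \<subseteq> {0<..}" "n \<in> A"
  hence n: "n > 0" by auto
  have "kernel x n \<le> 1 / (real n * (real n * (1 - x)))"
    unfolding kernel_def using n x diff_ge[OF n]
    by (intro divide_left_mono mult_left_mono mult_pos_pos) auto
  thus "kernel x n \<le> (1 / (1 - x)) * (1 / real n ^ 2)"
    by (simp add: power2_eq_square mult_ac)
qed (rule kernel_nonneg)

lemma summable_square: "A \<subseteq> {0<..} \<Longrightarrow> (\<lambda>n. 1 / (real n - x)^2) summable_on A"
proof (rule summable_on_comparison_test[OF summable_on_cmult_right[OF summable_inverse_squares]])
  fix n assume "A \<subseteq> {0<..}" "n \<in> A"
  hence n: "n > 0" by auto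
  have "1 / (real n - x)^2 \<le> 1 / (real n * (1 - x))^2"
    using n x diff_ge[OF n]
    by (intro divide_left_mono power_mono mult_pos_pos) auto
  thus "1 / (real n - x)^2 \<le> (1 / (1 - x)^2) * (1 / real n ^ 2)"
    by (simp add: power2_eq_square mult_ac)
qed auto

text \<open>
  Replace the inner sum $\sum_{j>b}1/(j-x)^2$ by a sum over $m$. In the summand $D(m,b)/m^2 \cdot w_b$
  the index $b$ occurs only in $C(m,b)\,w_b$, whose sum over $b$ is a tail of $\sum_n w_n$.
\<close>
lemma first_generating_sum:
  assumes "((\<lambda>(b, j). kernel x b * (1 / (real j - x)^2)) has_sum G) (Sigma {0<..} (\<lambda>b. {b<..}))"
  shows "((\<lambda>(m, n). fact_ratio x m / real m ^ 2 * kernel x n) has_sum G) (Sigma {0<..} (\<lambda>m. {m<..}))"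
proof -
  define R where "R b = (\<Sum>\<^sub>\<infinity>j\<in>{b<..}. 1 / (real j - x)^2)" for b
  define S where "S m = (\<Sum>\<^sub>\<infinity>n\<in>{m<..}. kernel x n)" for m
  have R: "((\<lambda>j. 1 / (real j - x)^2) has_sum R b) {b<..}" for b
    unfolding R_def by (intro has_sum_infsum summable_square) auto
  have S: "(kernel x has_sum S m) {m<..}" for m
    unfolding S_def by (intro has_sum_infsum summable_kernel) auto
  have rows: "((\<lambda>b. kernel x b * R b) has_sum G) {0<..}"
    by (rule has_sum_SigmaD[OF assms]) (unfold prod.case, rule has_sum_cmult_right[OF R])
  have "((\<lambda>m. fact_ratio x m / real m ^ 2 * S m) has_sum G) {0<..}"
  proof (rule has_sum_swap_nonneg[OF _ rows,
        where f = "\<lambda>b m. kernel x b * (fact_ratio x m * connector x m b / real m ^ 2)"])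
    fix b :: nat assume "b \<in> {0<..}"
    show "((\<lambda>m. kernel x b * (fact_ratio x m * connector x m b / real m ^ 2)) has_sum kernel x b * R b) {0<..}"
      by (intro has_sum_cmult_right transport_square R)
  next
    fix m :: nat assume "m \<in> {0<..}"
    show "((\<lambda>b. kernel x b * (fact_ratio x m * connector x m b / real m ^ 2)) has_sum fact_ratio x m / real m ^ 2 * S m) {0<..}"
      using has_sum_cmult_right[OF transport_kernel[OF S[of m]], of "fact_ratio x m / real m ^ 2"]
      by (simp add: mult_ac)
  next
    fix b m :: nat
    show "0 \<le> kernel x b * (fact_ratio x m * connector x m b / real m ^ 2)"
      using kernel_nonneg[of b] fact_ratio_pos[of m] connector_pos[of m b] by simp
  qed
  thus ?thesis
  proof (rule has_sum_SigmaI_nonneg[rotated], goal_cases)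
    case (2 m)
    show ?case unfolding prod.case by (rule has_sum_cmult_right[OF S])
  qed (simp add: kernel_nonneg fact_ratio_pos less_imp_le)
qed

text \<open>
  Replace the inner sum $\sum_{b>j} w_b$ by $\sum_m C(j,m)\,w_m$. Since $C(j,m)=D(m,j)/Q_m$, the sum
  over $j$ that is then left is a tail of $\sum_n Q_n/n^2$.
\<close>
lemma second_generating_sum:
  assumes "((\<lambda>(j, b). 1 / (real j - x)^2 * kernel x b) has_sum G) (Sigma {0<..} (\<lambda>j. {j<..}))"
  shows "((\<lambda>(m, n). kernel x m / fact_ratio x m * (fact_ratio x n / real n ^ 2)) has_sum G) (Sigma {0<..} (\<lambda>m. {m<..}))"
proof -
  define S where "S m = (\<Sum>\<^sub>\<infinity>n\<in>{m<..}. kernel x n)" for m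
  define R where "R m = (\<Sum>\<^sub>\<infinity>j\<in>{0<..}. fact_ratio x m * connector x m j / (real j - x)^2)" for m
  have S: "(kernel x has_sum S m) {m<..}" for m
    unfolding S_def by (intro has_sum_infsum summable_kernel) auto
  have R: "((\<lambda>j. fact_ratio x m * connector x m j / (real j - x)^2) has_sum R m) {0<..}" for m
    unfolding R_def
  proof (rule has_sum_infsum, rule summable_on_comparison_test)
    show "(\<lambda>j. fact_ratio x m * (1 / (real j - x)^2)) summable_on {0<..}"
      by (intro summable_on_cmult_right summable_square) auto
    fix j :: nat assume "j \<in> {0<..}"
    show "fact_ratio x m * connector x m j / (real j - x)^2 \<le> fact_ratio x m * (1 / (real j - x)^2)"
      using mult_left_mono[OF connector_le_1[of m j], of "fact_ratio x m"] fact_ratio_pos[of m]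
      by (simp add: divide_right_mono)
  qed (simp add: fact_ratio_pos connector_pos less_imp_le)
  have rows: "((\<lambda>j. 1 / (real j - x)^2 * S j) has_sum G) {0<..}"
    by (rule has_sum_SigmaD[OF assms]) (unfold prod.case, rule has_sum_cmult_right[OF S])
  have "((\<lambda>m. kernel x m / fact_ratio x m * R m) has_sum G) {0<..}"
  proof (rule has_sum_swap_nonneg[OF _ rows,
        where f = "\<lambda>j m. 1 / (real j - x)^2 * (connector x j m * kernel x m)"])
    fix j :: nat assume "j \<in> {0<..}"
    show "((\<lambda>m. 1 / (real j - x)^2 * (connector x j m * kernel x m)) has_sum 1 / (real j - x)^2 * S j) {0<..}"
      by (intro has_sum_cmult_right transport_kernel S)
  next
    fix m :: nat assume "m \<in> {0<..}"
    show "((\<lambda>j. 1 / (real j - x)^2 * (connector x j m * kernel x m)) has_sum kernel x m / fact_ratio x m * R m) {0<..}"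
      using has_sum_cmult_right[OF R[of m], of "kernel x m / fact_ratio x m"] fact_ratio_pos[of m]
      by (simp add: mult_ac connector_commute)
  next
    fix j m :: nat
    show "0 \<le> 1 / (real j - x)^2 * (connector x j m * kernel x m)"
      using kernel_nonneg[of m] connector_pos[of j m] by simp
  qed
  thus ?thesis
  proof (rule has_sum_SigmaI_nonneg[rotated], goal_cases)
    case (2 m)
    show ?case unfolding prod.case by (rule has_sum_cmult_right[OF transport_fact_ratio[OF R]])
  qed (simp add: kernel_nonneg fact_ratio_pos less_imp_le)
qed

end

section \<open>Truncated sums over compositions\<close>

definition chains :: "nat \<Rightarrow> nat \<Rightarrow> nat \<Rightarrow> nat list set" where
  "chains r l N = {k. length k = r \<and> sorted_wrt (<) k \<and> (\<forall>x\<in>set k. l < x \<and> x < N)}"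

definition truncated_mzv :: "nat list \<Rightarrow> nat \<Rightarrow> nat \<Rightarrow> real" where
  "truncated_mzv s l N = (\<Sum>k\<in>chains (length s) l N. \<Prod>i<length s. 1 / real (k ! i) ^ (s ! i))"

definition compositions :: "nat \<Rightarrow> nat list set" where
  "compositions q = {s. (\<forall>x\<in>set s. 1 \<le> x) \<and> sum_list s = q}"

text \<open>
  The number of parts is not fixed: a composition of $q$ with $a$ parts contributes $a$ to the depth
  and $q-a$ to the excess weight, and these are counted by the same power $x^q$.
\<close>
definition composition_sum :: "nat \<Rightarrow> nat \<Rightarrow> nat \<Rightarrow> real" where
  "composition_sum l N q = (\<Sum>s\<in>compositions q. truncated_mzv s l N)"

lemma finite_chains: "finite (chains r l N)"
  by (rule finite_subset[OF _ finite_lists_length_eq[of "{l<..<N}" r]]) (auto simp: chains_def)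

lemma truncated_mzv_nonneg: "0 \<le> truncated_mzv s l N"
  unfolding truncated_mzv_def by (intro sum_nonneg prod_nonneg) auto

lemma length_le_sum_list: "(\<forall>x\<in>set s. (1::nat) \<le> x) \<Longrightarrow> length s \<le> sum_list s"
  by (induction s) auto

lemma finite_compositions: "finite (compositions q)"
  by (rule finite_subset[OF _ finite_lists_length_le[of "{..q}" q]])
     (auto simp: compositions_def length_le_sum_list intro: member_le_sum_list)

lemma chains_Suc:
  assumes "l < N"
  shows "chains (Suc r) l (Suc N) = chains (Suc r) l N \<union> (\<lambda>k. k @ [N]) ` chains r l N"
proof (intro equalityI subsetI)
  fix k assume k: "k \<in> chains (Suc r) l (Suc N)"
  then obtain k' n where kn: "k = k' @ [n]" 
    by (cases k rule: rev_cases) (auto simp: chains_def)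
  show "k \<in> chains (Suc r) l N \<union> (\<lambda>k. k @ [N]) ` chains r l N"
  proof (cases "n = N")
    case True
    thus ?thesis using k kn by (auto simp: chains_def sorted_wrt_append)
  next
    case False
    hence "n < N" using k kn by (auto simp: chains_def)
    hence "\<forall>x\<in>set k. x < N" using k kn by (auto simp: chains_def sorted_wrt_append intro: less_trans)
    thus ?thesis using k by (auto simp: chains_def)
  qed
qed (use assms in \<open>auto simp: chains_def sorted_wrt_append less_Suc_eq\<close>)

lemma truncated_mzv_Nil: "truncated_mzv [] l N = 1"
proof -
  have "chains 0 l N = {[]}" by (auto simp: chains_def)
  thus ?thesis by (simp add: truncated_mzv_def)
qed

lemma truncated_mzv_snoc:
  assumes "l < N"
  shows "truncated_mzv (s @ [e]) l (Suc N) = truncated_mzv (s @ [e]) l N +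
    truncated_mzv s l N * (1 / real N ^ e)"
proof -
  let ?r = "length s" and ?f = "\<lambda>k. \<Prod>i<Suc (length s). 1 / real (k ! i) ^ ((s @ [e]) ! i)"
  have "truncated_mzv (s @ [e]) l (Suc N) = sum ?f (chains (Suc ?r) l N) + sum ?f ((\<lambda>k. k @ [N]) ` chains ?r l N)"
    unfolding truncated_mzv_def length_append_singleton chains_Suc[OF assms]
    by (rule sum.union_disjoint) (auto simp: finite_chains, auto simp: chains_def)
  also have "sum ?f ((\<lambda>k. k @ [N]) ` chains ?r l N) = (\<Sum>k\<in>chains ?r l N. ?f (k @ [N]))"
    by (rule sum.reindex[unfolded o_def]) (auto simp: inj_on_def)
  also have "\<dots> = (\<Sum>k\<in>chains ?r l N. (\<Prod>i<?r. 1 / real (k ! i) ^ (s ! i)) * (1 / real N ^ e))"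
    by (intro sum.cong refl) (auto simp: chains_def nth_append intro!: prod.cong)
  finally show ?thesis
    unfolding truncated_mzv_def sum_distrib_right by simp
qed

lemma truncated_mzv_empty_range: "s \<noteq> [] \<Longrightarrow> truncated_mzv s l (Suc l) = 0"
proof -
  assume "s \<noteq> []"
  hence "chains (length s) l (Suc l) = {}"
    by (auto simp: chains_def) (metis length_0_conv not_less_eq nth_mem length_greater_0_conv)
  thus ?thesis by (simp add: truncated_mzv_def)
qed

lemma sum_compositions:
  "(\<Sum>s\<in>compositions q. h s) = (if q = 0 then h [] else 0) + (\<Sum>i<q. \<Sum>s\<in>compositions i. h (s @ [q - i]))"
  for h :: "nat list \<Rightarrow> real"
proof -
  have "(\<Sum>s\<in>compositions q. h s) = (\<Sum>s\<in>compositions q \<inter> {[]}. h s) + (\<Sum>s\<in>compositions q - {[]}. h s)"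
    using finite_compositions by (subst sum.union_disjoint[symmetric]) (auto intro: sum.cong)
  also have "compositions q \<inter> {[]} = (if q = 0 then {[]} else {})"
    by (auto simp: compositions_def)
  also have "compositions q - {[]} = (\<lambda>(i, s). s @ [q - i]) ` Sigma {..<q} compositions"
  proof (intro equalityI subsetI)
    fix s assume s: "s \<in> compositions q - {[]}"
    then obtain s' n where "s = s' @ [n]" by (cases s rule: rev_cases) auto
    with s show "s \<in> (\<lambda>(i, s). s @ [q - i]) ` Sigma {..<q} compositions"
      by (intro image_eqI[of _ _ "(sum_list s', s')"]) (auto simp: compositions_def)
  qed (auto simp: compositions_def)
  also have "sum h \<dots> = (\<Sum>(i, s)\<in>Sigma {..<q} compositions. h (s @ [q - i]))"
    by (subst sum.reindex) (auto simp: inj_on_def compositions_def case_prod_unfold)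
  also have "\<dots> = (\<Sum>i<q. \<Sum>s\<in>compositions i. h (s @ [q - i]))"
    by (rule sum.Sigma[symmetric]) (auto simp: finite_compositions)
  finally show ?thesis by simp
qed

lemma composition_sum_nonneg: "0 \<le> composition_sum l N q"
  unfolding composition_sum_def by (intro sum_nonneg truncated_mzv_nonneg)

lemma composition_sum_base: "composition_sum l (Suc l) q = (if q = 0 then 1 else 0)"
  unfolding composition_sum_def by (subst sum_compositions) (simp add: truncated_mzv_Nil truncated_mzv_empty_range)

text \<open>
  Either $N$ does not occur in the chain, or it is the last entry and carries the last part $e\ge1$
  of the composition. The two cases are the terms $e=0$ and $e\ge1$ of one geometric series in $1/N$.
\<close>
lemma composition_sum_Suc:
  assumes "l < N"
  shows "composition_sum l (Suc N) q = cauchy_prod (composition_sum l N) (\<lambda>e. 1 / real N ^ e) q"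
proof -
  have "composition_sum l (Suc N) q = composition_sum l N q + (\<Sum>i<q. composition_sum l N i * (1 / real N ^ (q - i)))"
    unfolding composition_sum_def
    apply (subst (1 2) sum_compositions)
    apply (simp add: truncated_mzv_Nil truncated_mzv_snoc[OF assms] sum.distrib sum_divide_distrib)
    done
  thus ?thesis by (simp add: cauchy_prod_def lessThan_Suc_atMost[symmetric])
qed

lemma composition_sum_sums:
  assumes "0 \<le> x" "x < 1" "l < N"
  shows "(\<lambda>q. composition_sum l N q * x ^ q) sums (\<Prod>k\<in>{l<..<N}. real k / (real k - x))"
  using Suc_leI[OF assms(3)]
proof (induction N rule: dec_induct)
  case base
  have "(\<lambda>q. composition_sum l (Suc l) q * x ^ q) = (\<lambda>q. if q = 0 then 1 else 0)"
    by (auto simp: composition_sum_base fun_eq_iff)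
  moreover have "(\<lambda>q. if q = 0 then 1 else 0 :: real) sums 1"
    using sums_single[of 0 "\<lambda>_. 1 :: real"] by simp
  moreover have "{l<..<Suc l} = {}" by auto
  ultimately show ?case by simp
next
  case (step N)
  have "{l<..<Suc N} = insert N {l<..<N}" using step by auto
  moreover have "(\<lambda>q. composition_sum l (Suc N) q * x ^ q) sums
     ((\<Prod>k\<in>{l<..<N}. real k / (real k - x)) * (real N / (real N - x)))"
    using cauchy_prod_sums[OF composition_sum_nonneg _ assms(1) step.IH geometric_sums_inverse[of x N]] step assms
    by (simp add: composition_sum_Suc)
  ultimately show ?case by (simp add: mult.commute)
qed

text \<open>
  In this lemma and the next one, two of the summation indices are singled out. For fixed values
  $m<n$ of these, the others run over a finite set.
\<close>
lemma mzv_snoc2: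
  "mzv (s @ [e, c]) = (\<Sum>\<^sub>\<infinity>(m, n)\<in>Sigma {0<..} (\<lambda>m. {m<..}). truncated_mzv s 0 m * (1 / real m ^ e) * (1 / real n ^ c))"
proof -
  let ?r = "length s" and ?S = "Sigma {0<..} (\<lambda>m::nat. {m<..})"
  let ?f = "\<lambda>k. \<Prod>i<?r. 1 / real (k ! i) ^ (s ! i)"
  have "mzv (s @ [e, c]) = infsum (\<lambda>((m, n), k). ?f k * (1 / real m ^ e) * (1 / real n ^ c))
           (Sigma ?S (\<lambda>(m, n). chains ?r 0 m))"
    unfolding mzv_def
  proof (rule infsum_reindex_bij_witness[where i = "\<lambda>((m, n), k). k @ [m, n]"
        and j = "\<lambda>k. ((k ! ?r, k ! Suc ?r), take ?r k)"], goal_cases)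
    case (1 k)
    then obtain k' n m where "k = k' @ [m, n]"
      by (cases k rule: rev_cases; cases "butlast k" rule: rev_cases) auto
    thus ?case using 1 by (auto simp: nth_append)
  next
    case (2 k)
    then obtain k' n m where "k = k' @ [m, n]"
      by (cases k rule: rev_cases; cases "butlast k" rule: rev_cases) auto
    thus ?case using 2 by (auto simp: nth_append chains_def sorted_wrt_append Suc_le_eq)
  next
    case (3 y)
    thus ?case by (auto simp: chains_def nth_append)
  next
    case (4 y)
    thus ?case by (fastforce simp: chains_def sorted_wrt_append Suc_le_eq)
  next
    case (5 k)
    show ?case by (auto simp: nth_append intro!: prod.cong)
  qed
  also have "\<dots> = (\<Sum>\<^sub>\<infinity>(m, n)\<in>?S. truncated_mzv s 0 m * (1 / real m ^ e) * (1 / real n ^ c))"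
    by (subst infsum_Sigma_finite_fibres)
       (auto simp: finite_chains truncated_mzv_def sum_divide_distrib intro!: infsum_cong divide_nonneg_nonneg prod_nonneg)
  finally show ?thesis .
qed

lemma mzv_Cons_snoc:
  "mzv (e # s @ [c]) = (\<Sum>\<^sub>\<infinity>(m, n)\<in>Sigma {0<..} (\<lambda>m. {m<..}). truncated_mzv s m n * (1 / real m ^ e) * (1 / real n ^ c))"
proof -
  let ?r = "length s" and ?S = "Sigma {0<..} (\<lambda>m::nat. {m<..})"
  let ?f = "\<lambda>k. \<Prod>i<?r. 1 / real (k ! i) ^ (s ! i)"
  have "mzv (e # s @ [c]) = infsum (\<lambda>((m, n), k). ?f k * (1 / real m ^ e) * (1 / real n ^ c))
           (Sigma ?S (\<lambda>(m, n). chains ?r m n))"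
    unfolding mzv_def
  proof (rule infsum_reindex_bij_witness[where i = "\<lambda>((m, n), k). m # k @ [n]"
        and j = "\<lambda>k. ((hd k, last k), butlast (tl k))"], goal_cases)
    case (1 k)
    then obtain k' n m where "k = m # k' @ [n]"
      by (cases k; cases "tl k" rule: rev_cases) auto
    thus ?case by auto
  next
    case (2 k)
    then obtain k' n m where "k = m # k' @ [n]"
      by (cases k; cases "tl k" rule: rev_cases) auto
    thus ?case using 2 by (auto simp: chains_def sorted_wrt_append Suc_le_eq)
  next
    case (3 y)
    thus ?case by (auto simp: chains_def)
  next
    case (4 y)
    thus ?case by (auto simp: chains_def sorted_wrt_append Suc_le_eq intro: less_trans)
  next
    case (5 k)
    then obtain k' n m where "k = m # k' @ [n]"
      by (cases k; cases "tl k" rule: rev_cases) auto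
    moreover have "prod g {..<Suc (Suc ?r)} = g 0 * (\<Prod>i<?r. g (Suc i)) * g (Suc ?r)" for g :: "nat \<Rightarrow> real"
      by (subst prod.lessThan_Suc, subst prod.lessThan_Suc_shift) simp
    ultimately show ?case using 5
      by (auto simp: nth_append simp del: prod.lessThan_Suc intro!: prod.cong)
  qed
  also have "\<dots> = (\<Sum>\<^sub>\<infinity>(m, n)\<in>?S. truncated_mzv s m n * (1 / real m ^ e) * (1 / real n ^ c))"
    by (subst infsum_Sigma_finite_fibres)
       (auto simp: finite_chains truncated_mzv_def sum_divide_distrib intro!: infsum_cong divide_nonneg_nonneg prod_nonneg)
  finally show ?thesis .
qed

lemma mzv_single: "mzv [e] = (\<Sum>\<^sub>\<infinity>n\<in>{0<..}. 1 / real n ^ e)"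
  unfolding mzv_def
  by (rule infsum_reindex_bij_witness[where i = "\<lambda>n. [n]" and j = hd])
     (auto simp: length_Suc_conv Suc_le_eq)

section \<open>Coefficients of the two generating functions\<close>

definition zeta_coeff :: "nat \<Rightarrow> nat \<Rightarrow> real" where
  "zeta_coeff m e = 1 / real m ^ (e + 2)"

lemma zeta_coeff_nonneg: "0 \<le> zeta_coeff m e"
  by (simp add: zeta_coeff_def)

lemma zeta_coeff_sums:
  assumes "0 \<le> x" "x < 1" "m > 0"
  shows "(\<lambda>e. zeta_coeff m e * x ^ e) sums kernel x m"
  using sums_mult[OF geometric_sums_inverse[of x m], of "1 / real m ^ 2"] assms
  by (simp add: zeta_coeff_def kernel_def power2_eq_square power_add mult_ac)

lemma zeta_coeff_weighted_sums:
  assumes "0 \<le> x" "x < 1" "m > 0"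
  shows "(\<lambda>e. (real e + 1) * zeta_coeff m e * x ^ e) sums (1 / (real m - x)^2)"
proof -
  have x: "x < real m" using assms by simp
  have "cauchy_prod (\<lambda>n. 1 / real m ^ n) (\<lambda>n. 1 / real m ^ n) e = (real e + 1) * (1 / real m ^ e)" for e
    unfolding cauchy_prod_def by (simp add: power_add[symmetric])
  hence "(\<lambda>e. (real e + 1) * (1 / real m ^ e) * x ^ e) sums ((real m / (real m - x)) * (real m / (real m - x)))"
    using cauchy_prod_sums[OF _ _ assms(1) geometric_sums_inverse[OF assms(1) x] geometric_sums_inverse[OF assms(1) x]]
    by simp
  from sums_mult[OF this, of "1 / real m ^ 2"] show ?thesis using assms(3)
    by (simp add: zeta_coeff_def power2_eq_square power_add mult_ac)
qed

text \<open>
  This puts $Q_{n-1}w_n/Q_m$ into the form $Q_n/(n^2Q_m)$ in which the transport rules produce it;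
  for $m=0$ it is $Q_{n-1}w_n=Q_n/n^2$.
\<close>
lemma fact_ratio_interval:
  assumes "0 \<le> x" "x < 1" "m < n"
  shows "(\<Prod>k\<in>{m<..<n}. real k / (real k - x)) * kernel x n = fact_ratio x n / real n ^ 2 / fact_ratio x m"
proof -
  have *: "(\<Prod>k\<in>{m<..<n}. real k / (real k - x)) * (real n / (real n - x)) * fact_ratio x m = fact_ratio x n"
    using Suc_leI[OF assms(3)]
  proof (induction n rule: dec_induct)
    case base
    have "{m<..<Suc m} = {}" by auto
    thus ?case using fact_ratio_Suc[OF assms(1,2), of m] by (simp add: mult_ac)
  next
    case (step n)
    have "{m<..<Suc n} = insert n {m<..<n}" using step by auto
    thus ?case unfolding fact_ratio_Suc[OF assms(1,2), of n] step.IH[symmetric]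
      by (simp add: mult_ac del: of_nat_Suc)
  qed
  show ?thesis using assms fact_ratio_pos[OF assms(1,2), of m]
    unfolding *[symmetric] kernel_def by (simp add: power2_eq_square)
qed

text \<open>
  The coefficients of $x^p$ in the terms of $G_1$ and $G_2$ that belong to $(m,n)$, and in
  $w_b/(j-x)^2$.
\<close>
definition first_coeff :: "nat \<Rightarrow> nat \<times> nat \<Rightarrow> real" where
  "first_coeff p = (\<lambda>(m, n). cauchy_prod (cauchy_prod (composition_sum 0 m) (zeta_coeff m)) (zeta_coeff n) p)"

definition second_coeff :: "nat \<Rightarrow> nat \<times> nat \<Rightarrow> real" where
  "second_coeff p = (\<lambda>(m, n). cauchy_prod (cauchy_prod (composition_sum m n) (zeta_coeff m)) (zeta_coeff n) p)"

definition pair_coeff :: "nat \<Rightarrow> nat \<times> nat \<Rightarrow> real" where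
  "pair_coeff p = (\<lambda>(b, j). cauchy_prod (zeta_coeff b) (\<lambda>v. (real v + 1) * zeta_coeff j v) p)"

abbreviation "increasing_pairs \<equiv> Sigma {0<..} (\<lambda>m::nat. {m<..})"

lemma pair_coeff_nonneg: "0 \<le> pair_coeff p y"
  by (cases y) (auto simp: pair_coeff_def intro!: cauchy_prod_nonneg zeta_coeff_nonneg mult_nonneg_nonneg)

lemma first_coeff_nonneg: "0 \<le> first_coeff p y"
  by (cases y) (auto simp: first_coeff_def intro!: cauchy_prod_nonneg zeta_coeff_nonneg composition_sum_nonneg)

lemma second_coeff_nonneg: "0 \<le> second_coeff p y"
  by (cases y) (auto simp: second_coeff_def intro!: cauchy_prod_nonneg zeta_coeff_nonneg composition_sum_nonneg)

lemma pair_coeff_sums: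
  assumes "0 \<le> x" "x < 1" "b > 0" "j > 0"
  shows "(\<lambda>p. pair_coeff p (b, j) * x ^ p) sums (kernel x b * (1 / (real j - x)^2))"
  unfolding pair_coeff_def prod.case
  using assms by (intro cauchy_prod_sums zeta_coeff_sums zeta_coeff_weighted_sums zeta_coeff_nonneg mult_nonneg_nonneg) auto

lemma first_coeff_sums:
  assumes "0 \<le> x" "x < 1" "0 < m" "m < n"
  shows "(\<lambda>p. first_coeff p (m, n) * x ^ p) sums (fact_ratio x m / real m ^ 2 * kernel x n)"
proof -
  have "(\<lambda>p. first_coeff p (m, n) * x ^ p) sums ((\<Prod>k\<in>{0<..<m}. real k / (real k - x)) * kernel x m * kernel x n)"
    unfolding first_coeff_def prod.case
    using assms by (intro cauchy_prod_sums cauchy_prod_nonneg zeta_coeff_sums composition_sum_sums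
      zeta_coeff_nonneg composition_sum_nonneg) auto
  thus ?thesis using assms by (simp add: fact_ratio_interval fact_ratio_0)
qed

lemma second_coeff_sums:
  assumes "0 \<le> x" "x < 1" "0 < m" "m < n"
  shows "(\<lambda>p. second_coeff p (m, n) * x ^ p) sums (kernel x m / fact_ratio x m * (fact_ratio x n / real n ^ 2))"
proof -
  have "(\<lambda>p. second_coeff p (m, n) * x ^ p) sums ((\<Prod>k\<in>{m<..<n}. real k / (real k - x)) * kernel x m * kernel x n)"
    unfolding second_coeff_def prod.case
    using assms by (intro cauchy_prod_sums cauchy_prod_nonneg zeta_coeff_sums composition_sum_sums
      zeta_coeff_nonneg composition_sum_nonneg) auto
  moreover have "(\<Prod>k\<in>{m<..<n}. real k / (real k - x)) * kernel x m * kernel x n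
    = kernel x m / fact_ratio x m * (fact_ratio x n / real n ^ 2)"
    using fact_ratio_interval[of x m n] assms by (simp add: mult_ac)
  ultimately show ?thesis by simp
qed

lemma summable_product:
  assumes "0 \<le> x" "x < 1"
  shows "(\<lambda>(b, j). kernel x b * (1 / (real j - x)^2)) summable_on ({0<..} \<times> {0<..})"
proof -
  define R where "R = (\<Sum>\<^sub>\<infinity>j\<in>{0<..}. 1 / (real j - x)^2)"
  have "((\<lambda>j. 1 / (real j - x)^2) has_sum R) {0<..}"
    unfolding R_def using summable_square[OF assms] by (intro has_sum_infsum) auto
  thus ?thesis
    by (intro summable_on_SigmaI[where g = "\<lambda>b. kernel x b * R"] summable_on_cmult_left summable_kernel assms)
       (unfold prod.case, auto intro!: has_sum_cmult_right mult_nonneg_nonneg kernel_nonneg assms simp del: times_divide_eq_right)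
qed

lemma first_coeff_has_sum: "(first_coeff p has_sum infsum (pair_coeff p) increasing_pairs) increasing_pairs"
  and pair_coeff_summable: "pair_coeff p summable_on increasing_pairs"
proof -
  define V where "V x = (\<Sum>\<^sub>\<infinity>(b, j)\<in>increasing_pairs. kernel x b * (1 / (real j - x)^2))" for x
  have V: "((\<lambda>(b, j). kernel x b * (1 / (real j - x)^2)) has_sum V x) increasing_pairs" if "0 < x" "x < 1" for x
    unfolding V_def using that
    by (intro has_sum_infsum summable_on_subset_banach[OF summable_product]) auto
  have W: "((\<lambda>(m, n). fact_ratio x m / real m ^ 2 * kernel x n) has_sum V x) increasing_pairs" if "0 < x" "x < 1" for x
    using first_generating_sum[OF _ _ V[OF that]] that by simp
  have a: "(\<lambda>p. first_coeff p y * x ^ p) sums (case y of (m, n) \<Rightarrow> fact_ratio x m / real m ^ 2 * kernel x n)"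
    if "0 < x" "x < 1" "y \<in> increasing_pairs" for x y
    using first_coeff_sums[of x "fst y" "snd y"] that by (cases y) simp
  have b: "(\<lambda>p. pair_coeff p y * x ^ p) sums (case y of (b, j) \<Rightarrow> kernel x b * (1 / (real j - x)^2))"
    if "0 < x" "x < 1" "y \<in> increasing_pairs" for x y
    using pair_coeff_sums[of x "fst y" "snd y"] that by (cases y) simp
  show "(first_coeff p has_sum infsum (pair_coeff p) increasing_pairs) increasing_pairs"
    by (rule coefficientwise_equality(1)[OF first_coeff_nonneg pair_coeff_nonneg a b W V])
  show "pair_coeff p summable_on increasing_pairs"
    by (rule coefficientwise_equality(2)[OF first_coeff_nonneg pair_coeff_nonneg a b W V])
qed

lemma second_coeff_has_sum: "(second_coeff p has_sum infsum (\<lambda>(j, b). pair_coeff p (b, j)) increasing_pairs) increasing_pairs"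
  and pair_coeff_summable': "(\<lambda>(j, b). pair_coeff p (b, j)) summable_on increasing_pairs"
proof -
  define V where "V x = (\<Sum>\<^sub>\<infinity>(j, b)\<in>increasing_pairs. 1 / (real j - x)^2 * kernel x b)" for x
  have V: "((\<lambda>(j, b). 1 / (real j - x)^2 * kernel x b) has_sum V x) increasing_pairs" if "0 < x" "x < 1" for x
    unfolding V_def
  proof (intro has_sum_infsum)
    have "(\<lambda>(j, b). 1 / (real j - x)^2 * kernel x b) summable_on ({0<..} \<times> {0<..})"
      using summable_product[of x] that
      by (subst summable_on_swap) (simp add: case_prod_unfold mult_ac)
    thus "(\<lambda>(j, b). 1 / (real j - x)^2 * kernel x b) summable_on increasing_pairs"
      by (rule summable_on_subset_banach) auto
  qed
  have W: "((\<lambda>(m, n). kernel x m / fact_ratio x m * (fact_ratio x n / real n ^ 2)) has_sum V x) increasing_pairs" if "0 < x" "x < 1" for x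
    using second_generating_sum[OF _ _ V[OF that]] that by simp
  have a: "(\<lambda>p. second_coeff p y * x ^ p) sums (case y of (m, n) \<Rightarrow> kernel x m / fact_ratio x m * (fact_ratio x n / real n ^ 2))"
    if "0 < x" "x < 1" "y \<in> increasing_pairs" for x y
    using second_coeff_sums[of x "fst y" "snd y"] that by (cases y) simp
  have b: "(\<lambda>p. (\<lambda>(j, b). pair_coeff p (b, j)) y * x ^ p) sums (case y of (j, b) \<Rightarrow> 1 / (real j - x)^2 * kernel x b)"
    if "0 < x" "x < 1" "y \<in> increasing_pairs" for x y
    using pair_coeff_sums[of x "snd y" "fst y"] that by (cases y) (simp add: mult_ac)
  have nonneg: "0 \<le> (\<lambda>(j, b). pair_coeff p (b, j)) y" for p y
    by (cases y) (simp add: pair_coeff_nonneg)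
  show "(second_coeff p has_sum infsum (\<lambda>(j, b). pair_coeff p (b, j)) increasing_pairs) increasing_pairs"
    by (rule coefficientwise_equality(1)[OF second_coeff_nonneg nonneg a b W V])
  show "(\<lambda>(j, b). pair_coeff p (b, j)) summable_on increasing_pairs"
    by (rule coefficientwise_equality(2)[OF second_coeff_nonneg nonneg a b W V])
qed

section \<open>The weighted sum identity\<close>

text \<open>
  The common index set of the sums over the tuples $\alpha$ and over the tuples $\beta$. The last part
  of the tuple is split off as one of the two numbers, decreased by $1$; the depth is then determined
  by the length of the remaining list.
\<close>
definition marked_compositions :: "nat \<Rightarrow> (nat list \<times> nat \<times> nat) set" where
  "marked_compositions p = {(s, e, c). (\<forall>x\<in>set s. 1 \<le> x) \<and> sum_list s + e + c = p}"

lemma finite_marked_compositions: "finite (marked_compositions p)"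
proof (rule finite_subset)
  show "marked_compositions p \<subseteq> (\<Union>q\<le>p. compositions q) \<times> {..p} \<times> {..p}"
    by (auto simp: marked_compositions_def compositions_def)
qed (auto simp: finite_compositions)

lemma cauchy_prod_composition_sum:
  "cauchy_prod (cauchy_prod (composition_sum l N) f) g p = (\<Sum>(s, e, c)\<in>marked_compositions p. truncated_mzv s l N * f e * g c)"
proof -
  have "cauchy_prod (cauchy_prod (composition_sum l N) f) g p = (\<Sum>i\<le>p. \<Sum>j\<le>i. \<Sum>s\<in>compositions j. truncated_mzv s l N * f (i - j) * g (p - i))"
    by (simp add: cauchy_prod_def composition_sum_def sum_distrib_right)
  also have "\<dots> = (\<Sum>(i, j, s)\<in>Sigma {..p} (\<lambda>i. Sigma {..i} compositions). truncated_mzv s l N * f (i - j) * g (p - i))"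
    by (subst sum.Sigma, simp, simp add: finite_compositions, subst sum.Sigma)
       (auto simp: finite_compositions case_prod_unfold)
  also have "\<dots> = (\<Sum>(s, e, c)\<in>marked_compositions p. truncated_mzv s l N * f e * g c)"
    by (rule sum.reindex_bij_witness[where j = "\<lambda>(i, j, s). (s, i - j, p - i)"
          and i = "\<lambda>(s, e, c). (sum_list s + e, sum_list s, s)"])
       (auto simp: marked_compositions_def compositions_def)
  finally show ?thesis .
qed

text \<open>
  The total over all marked compositions is summable by comparison of generating functions, and it
  dominates every single multiple zeta series in the sum.
\<close>
lemma sum_mzv_first:
  "(\<Sum>(s, e, c)\<in>marked_compositions p. mzv (s @ [e + 2, c + 2])) = infsum (pair_coeff p) increasing_pairs"
proof -
  define h where "h = (\<lambda>(s, e, c) (m, n). truncated_mzv s 0 m * zeta_coeff m e * zeta_coeff n c)"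
  have "(\<Sum>\<omega>\<in>marked_compositions p. infsum (h \<omega>) increasing_pairs) = infsum (pair_coeff p) increasing_pairs"
  proof (rule sum_infsum_dominated)
    have "(\<lambda>y. \<Sum>\<omega>\<in>marked_compositions p. h \<omega> y) = first_coeff p"
      by (auto simp: fun_eq_iff first_coeff_def cauchy_prod_composition_sum h_def case_prod_unfold)
    thus "((\<lambda>y. \<Sum>\<omega>\<in>marked_compositions p. h \<omega> y) has_sum infsum (pair_coeff p) increasing_pairs) increasing_pairs"
      using first_coeff_has_sum by simp
  qed (auto simp: finite_marked_compositions h_def truncated_mzv_nonneg zeta_coeff_nonneg)
  moreover have "mzv (s @ [e + 2, c + 2]) = infsum (h (s, e, c)) increasing_pairs" for s e c
    by (simp add: mzv_snoc2 h_def zeta_coeff_def)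
  ultimately show ?thesis by (simp add: case_prod_unfold)
qed

lemma sum_mzv_second:
  "(\<Sum>(s, e, c)\<in>marked_compositions p. mzv ((e + 2) # s @ [c + 2])) = infsum (\<lambda>(j, b). pair_coeff p (b, j)) increasing_pairs"
proof -
  define h where "h = (\<lambda>(s, e, c) (m, n). truncated_mzv s m n * zeta_coeff m e * zeta_coeff n c)"
  have "(\<Sum>\<omega>\<in>marked_compositions p. infsum (h \<omega>) increasing_pairs) = infsum (\<lambda>(j, b). pair_coeff p (b, j)) increasing_pairs"
  proof (rule sum_infsum_dominated)
    have "(\<lambda>y. \<Sum>\<omega>\<in>marked_compositions p. h \<omega> y) = second_coeff p"
      by (auto simp: fun_eq_iff second_coeff_def cauchy_prod_composition_sum h_def case_prod_unfold)
    thus "((\<lambda>y. \<Sum>\<omega>\<in>marked_compositions p. h \<omega> y) has_sum infsum (\<lambda>(j, b). pair_coeff p (b, j)) increasing_pairs) increasing_pairs"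
      using second_coeff_has_sum by simp
  qed (auto simp: finite_marked_compositions h_def truncated_mzv_nonneg zeta_coeff_nonneg)
  moreover have "mzv ((e + 2) # s @ [c + 2]) = infsum (h (s, e, c)) increasing_pairs" for s e c
    by (simp add: mzv_Cons_snoc h_def zeta_coeff_def)
  ultimately show ?thesis by (simp add: case_prod_unfold)
qed

lemma finite_triples: "finite {(a, b, c). a + b + c = (p::nat)}"
  by (rule finite_subset[of _ "{..p} \<times> {..p} \<times> {..p}"]) auto

lemma pos_tuples_Suc:
  "\<alpha> \<in> pos_tuples (Suc a) n \<longleftrightarrow>
     (\<exists>s e. \<alpha> = s @ [Suc e] \<and> length s = a \<and> (\<forall>x\<in>set s. 1 \<le> x) \<and> sum_list s + Suc e = n)"
proof
  assume "\<alpha> \<in> pos_tuples (Suc a) n"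
  then obtain s x where "\<alpha> = s @ [x]" "x \<ge> 1" "length s = a" "\<forall>x\<in>set s. 1 \<le> x" "sum_list s + x = n"
    by (cases \<alpha> rule: rev_cases) (auto simp: pos_tuples_def)
  thus "\<exists>s e. \<alpha> = s @ [Suc e] \<and> length s = a \<and> (\<forall>x\<in>set s. 1 \<le> x) \<and> sum_list s + Suc e = n"
    by (intro exI[of _ s] exI[of _ "x - 1"]) auto
qed (auto simp: pos_tuples_def)

lemma reindex_first:
  fixes f :: "nat list \<Rightarrow> real"
  shows "(\<Sum>(a, b, c) \<in> {(a, b, c). a + b + c = p}.
            \<Sum>\<alpha> \<in> pos_tuples (a + 1) (a + b + 1). f (\<alpha>[a := \<alpha> ! a + 1] @ [c + 2]))
         = (\<Sum>(s, e, c)\<in>marked_compositions p. f (s @ [e + 2, c + 2]))"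
proof -
  have length_le: "length s + (sum_list s + e - length s) = sum_list s + e" if "\<forall>x\<in>set s. Suc 0 \<le> x" for s e
    using length_le_sum_list[of s] that by simp
  have "(\<Sum>(a, b, c) \<in> {(a, b, c). a + b + c = p}.
            \<Sum>\<alpha> \<in> pos_tuples (a + 1) (a + b + 1). f (\<alpha>[a := \<alpha> ! a + 1] @ [c + 2]))
      = (\<Sum>((a, b, c), \<alpha>) \<in> Sigma {(a, b, c). a + b + c = p} (\<lambda>(a, b, c). pos_tuples (a + 1) (a + b + 1)).
            f (\<alpha>[a := \<alpha> ! a + 1] @ [c + 2]))"
    using sum.Sigma[OF finite_triples[of p], of "\<lambda>(a, b, c). pos_tuples (a + 1) (a + b + 1)"
        "\<lambda>(a, b, c) \<alpha>. f (\<alpha>[a := \<alpha> ! a + 1] @ [c + 2])"]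
    by (simp add: case_prod_unfold finite_pos_tuples)
  also have "\<dots> = (\<Sum>(s, e, c)\<in>marked_compositions p. f (s @ [e + 2, c + 2]))"
    by (rule sum.reindex_bij_witness[where
          j = "\<lambda>((a, b, c), \<alpha>). (butlast \<alpha>, last \<alpha> - 1, c)" and
          i = "\<lambda>(s, e, c). ((length s, sum_list s + e - length s, c), s @ [Suc e])"])
       (use length_le in \<open>auto simp: marked_compositions_def pos_tuples_Suc\<close>)
  finally show ?thesis .
qed

lemma reindex_second:
  fixes f :: "nat list \<Rightarrow> real"
  shows "(\<Sum>(a, b, c) \<in> {(a, b, c). a + b + c = p}.
            \<Sum>\<beta> \<in> pos_tuples (b + 1) (b + c + 1). f ((a + 2) # \<beta>[b := \<beta> ! b + 1]))
         = (\<Sum>(s, e, c)\<in>marked_compositions p. f ((e + 2) # s @ [c + 2]))"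
proof -
  have length_le: "length s + (sum_list s + e - length s) = sum_list s + e" if "\<forall>x\<in>set s. Suc 0 \<le> x" for s e
    using length_le_sum_list[of s] that by simp
  have "(\<Sum>(a, b, c) \<in> {(a, b, c). a + b + c = p}.
            \<Sum>\<beta> \<in> pos_tuples (b + 1) (b + c + 1). f ((a + 2) # \<beta>[b := \<beta> ! b + 1]))
      = (\<Sum>((a, b, c), \<beta>) \<in> Sigma {(a, b, c). a + b + c = p} (\<lambda>(a, b, c). pos_tuples (b + 1) (b + c + 1)).
            f ((a + 2) # \<beta>[b := \<beta> ! b + 1]))"
    using sum.Sigma[OF finite_triples[of p], of "\<lambda>(a, b, c). pos_tuples (b + 1) (b + c + 1)"
        "\<lambda>(a, b, c) \<beta>. f ((a + 2) # \<beta>[b := \<beta> ! b + 1])"]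
    by (simp add: case_prod_unfold finite_pos_tuples)
  also have "\<dots> = (\<Sum>(s, e, c)\<in>marked_compositions p. f ((e + 2) # s @ [c + 2]))"
    by (rule sum.reindex_bij_witness[where
          j = "\<lambda>((a, b, c), \<beta>). (butlast \<beta>, a, last \<beta> - 1)" and
          i = "\<lambda>(s, e, c). ((e, length s, sum_list s + c - length s), s @ [Suc c])"])
       (use length_le in \<open>auto simp: marked_compositions_def pos_tuples_Suc\<close>)
  finally show ?thesis .
qed

lemma zeta_has_sum: "((\<lambda>n. zeta_coeff n e) has_sum mzv [e + 2]) {0<..}"
proof -
  have "(\<lambda>n. zeta_coeff n e) summable_on {0<..}"
  proof (rule summable_on_comparison_test[OF summable_inverse_squares])
    fix n :: nat assume "n \<in> {0<..}"
    thus "zeta_coeff n e \<le> 1 / real n ^ 2"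
      unfolding zeta_coeff_def by (intro divide_left_mono power_increasing) auto
  qed (simp add: zeta_coeff_nonneg)
  thus ?thesis
    unfolding mzv_single zeta_coeff_def by (rule has_sum_infsum)
qed

lemma pair_coeff_total:
  "(pair_coeff p has_sum (\<Sum>i\<le>p. (real (p - i) + 1) * (mzv [i + 2] * mzv [p - i + 2]))) ({0<..} \<times> {0<..})"
proof -
  have "((\<lambda>(b, j). zeta_coeff b i * ((real (p - i) + 1) * zeta_coeff j (p - i))) has_sum
         mzv [i + 2] * ((real (p - i) + 1) * mzv [p - i + 2])) ({0<..} \<times> {0<..})" for i
  proof (rule has_sum_SigmaI_nonneg)
    fix b :: nat
    show "((\<lambda>j. case (b, j) of (b, j) \<Rightarrow> zeta_coeff b i * ((real (p - i) + 1) * zeta_coeff j (p - i))) has_sum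
           zeta_coeff b i * ((real (p - i) + 1) * mzv [p - i + 2])) {0<..}"
      unfolding prod.case by (intro has_sum_cmult_right zeta_has_sum)
    show "((\<lambda>b. zeta_coeff b i * ((real (p - i) + 1) * mzv [p - i + 2])) has_sum
         mzv [i + 2] * ((real (p - i) + 1) * mzv [p - i + 2])) {0<..}"
      by (intro has_sum_cmult_left zeta_has_sum)
  qed (auto simp: zeta_coeff_nonneg)
  from has_sum_finite_sum[OF finite_atMost this]
  have "((\<lambda>y. \<Sum>i\<le>p. case y of (b, j) \<Rightarrow> zeta_coeff b i * ((real (p - i) + 1) * zeta_coeff j (p - i))) has_sum
      (\<Sum>i\<le>p. mzv [i + 2] * ((real (p - i) + 1) * mzv [p - i + 2]))) ({0<..} \<times> {0<..})"
    .
  moreover have "(\<lambda>y. \<Sum>i\<le>p. case y of (b, j) \<Rightarrow> zeta_coeff b i * ((real (p - i) + 1) * zeta_coeff j (p - i))) = pair_coeff p"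
    by (auto simp: fun_eq_iff pair_coeff_def cauchy_prod_def)
  ultimately show ?thesis by (simp add: mult_ac)
qed

lemma pair_coeff_diagonal:
  "((\<lambda>n. pair_coeff p (n, n)) has_sum (real p + 1) * (real p + 2) / 2 * mzv [p + 4]) {0<..}"
proof -
  have "pair_coeff p (n, n) = (real p + 1) * (real p + 2) / 2 * zeta_coeff n (p + 2)" for n
  proof -
    have "pair_coeff p (n, n) = (\<Sum>i\<le>p. (real (p - i) + 1) * zeta_coeff n (p + 2))"
      unfolding pair_coeff_def cauchy_prod_def prod.case
    proof (intro sum.cong refl)
      fix i assume "i \<in> {..p}"
      hence "zeta_coeff n i * zeta_coeff n (p - i) = zeta_coeff n (p + 2)"
        by (simp add: zeta_coeff_def power_add[symmetric])
      thus "zeta_coeff n i * ((real (p - i) + 1) * zeta_coeff n (p - i)) = (real (p - i) + 1) * zeta_coeff n (p + 2)"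
        by (simp add: algebra_simps)
    qed
    also have "\<dots> = (\<Sum>i\<le>p. real i + 1) * zeta_coeff n (p + 2)"
      unfolding sum_distrib_right[symmetric]
      by (subst sum.nat_diff_reindex[symmetric, of _ "Suc p", unfolded lessThan_Suc_atMost]) simp
    also have "(\<Sum>i\<le>p. real i + 1) = (real p + 1) * (real p + 2) / 2"
      by (induction p) (auto simp: field_simps)
    finally show ?thesis .
  qed
  moreover have "p + 2 + 2 = p + 4" by simp
  ultimately show ?thesis
    using has_sum_cmult_right[OF zeta_has_sum[of "p + 2"], of "(real p + 1) * (real p + 2) / 2"]
    by (simp only:)
qed

text \<open>Average the sum with its reversal $i\mapsto p-i$; the two weights add up to $p+2$.\<close>
lemma symmetrize:
  fixes z :: "nat \<Rightarrow> real"
  shows "(\<Sum>i\<le>p. (real (p - i) + 1) * (z i * z (p - i))) = (real p + 2) / 2 * (\<Sum>i\<le>p. z i * z (p - i))"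
proof -
  let ?X = "\<Sum>i\<le>p. (real (p - i) + 1) * (z i * z (p - i))"
  have "?X = (\<Sum>i\<le>p. (real i + 1) * (z i * z (p - i)))"
    by (rule sum.reindex_bij_witness[where i = "\<lambda>i. p - i" and j = "\<lambda>i. p - i"]) auto
  hence "?X + ?X = (\<Sum>i\<le>p. (real (p - i) + 1) * (z i * z (p - i)) + (real i + 1) * (z i * z (p - i)))"
    by (simp add: sum.distrib)
  also have "\<dots> = (\<Sum>i\<le>p. (real p + 2) * (z i * z (p - i)))"
    by (intro sum.cong refl) (simp add: of_nat_diff algebra_simps)
  finally show ?thesis by (simp add: sum_distrib_left[symmetric])
qed

text \<open>
  Splits $\sum_{b,j}$ into the parts $b<j$, $j<b$ and $b=j$. The full sum factors into products of two
  zeta values, and the diagonal is a multiple of $\zeta(p+4)$.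
\<close>
lemma pair_coeff_split:
  "infsum (pair_coeff p) increasing_pairs + infsum (\<lambda>(j, b). pair_coeff p (b, j)) increasing_pairs + (real p + 1) * (real p + 2) / 2 * mzv [p + 4]
     = (real p + 2) / 2 * (\<Sum>i\<le>p. mzv [i + 2] * mzv [p - i + 2])"
proof -
  define lower where "lower = (\<lambda>(j, b). (b, j)) ` increasing_pairs"
  define diag where "diag = (\<lambda>n::nat. (n, n)) ` {0<..}"
  have "(pair_coeff p has_sum infsum (pair_coeff p) increasing_pairs) increasing_pairs"
    using pair_coeff_summable by (rule has_sum_infsum)
  moreover have "(pair_coeff p has_sum infsum (\<lambda>(j, b). pair_coeff p (b, j)) increasing_pairs) lower"
    unfolding lower_def
    by (subst has_sum_reindex)
       (use has_sum_infsum[OF pair_coeff_summable'[of p]] in \<open>auto simp: inj_on_def o_def case_prod_unfold\<close>)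
  moreover have "(pair_coeff p has_sum (real p + 1) * (real p + 2) / 2 * mzv [p + 4]) diag"
    unfolding diag_def
    by (subst has_sum_reindex) (use pair_coeff_diagonal[of p] in \<open>auto simp: inj_on_def o_def\<close>)
  ultimately have "(pair_coeff p has_sum infsum (pair_coeff p) increasing_pairs + infsum (\<lambda>(j, b). pair_coeff p (b, j)) increasing_pairs
        + (real p + 1) * (real p + 2) / 2 * mzv [p + 4]) (increasing_pairs \<union> lower \<union> diag)"
    by (intro has_sum_Un_disjoint) (auto simp: lower_def diag_def)
  also have "increasing_pairs \<union> lower \<union> diag = {0<..} \<times> {0<..}"
    by (auto simp: lower_def diag_def image_iff)
  finally show ?thesis
    using has_sum_unique[OF _ pair_coeff_total[of p]] symmetrize[of p "\<lambda>i. mzv [i + 2]"] by simp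
qed

theorem theorem6p1:
  fixes p :: nat
  shows "(\<Sum>(a, b, c) \<in> {(a, b, c). a + b + c = p}.
            (\<Sum>\<alpha> \<in> pos_tuples (a + 1) (a + b + 1). mzv (\<alpha>[a := \<alpha> ! a + 1] @ [c + 2])) +
            (\<Sum>\<beta> \<in> pos_tuples (b + 1) (b + c + 1). mzv ((a + 2) # \<beta>[b := \<beta> ! b + 1])))
       = (real p + 2) / 2 * (\<Sum>(m, n) \<in> {(m, n). m + n = p}. mzv [m + 2] * mzv [n + 2])
         - (real p + 1) * (real p + 2) / 2 * mzv [p + 4]"
proof -
  have antidiagonal: "(\<Sum>(m, n) \<in> {(m, n). m + n = p}. mzv [m + 2] * mzv [n + 2])
      = (\<Sum>i\<le>p. mzv [i + 2] * mzv [p - i + 2])"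
    by (rule sum.reindex_bij_witness[where j = fst and i = "\<lambda>i. (i, p - i)"]) auto
  have "(\<Sum>(a, b, c) \<in> {(a, b, c). a + b + c = p}.
            (\<Sum>\<alpha> \<in> pos_tuples (a + 1) (a + b + 1). mzv (\<alpha>[a := \<alpha> ! a + 1] @ [c + 2])) +
            (\<Sum>\<beta> \<in> pos_tuples (b + 1) (b + c + 1). mzv ((a + 2) # \<beta>[b := \<beta> ! b + 1])))
      = infsum (pair_coeff p) increasing_pairs + infsum (\<lambda>(j, b). pair_coeff p (b, j)) increasing_pairs"
    using reindex_first[of mzv p] reindex_second[of mzv p] sum_mzv_first[of p] sum_mzv_second[of p]
    by (simp add: case_prod_unfold sum.distrib)
  thus ?thesis
    using pair_coeff_split[of p] unfolding antidiagonal by linarith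
qed

end
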